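(* Consider an inference problem with unknown of interest $\theta\in\Theta$, nuisance variable $\phi\in\Phi$, data $x\in X$, set $H\subseteq\Theta\times\Phi$ of possible combinations $h=(\theta,\phi)$, and likelihood $P(x|\theta,\phi)$. Then: (i) for any prior probability measure $P(h)=P(\theta,\phi)$ on $H$, its associated Bayesian solution (the family of posterior distributions $R_x=P(\theta|x)$ on $\Theta$ computed by Bayes' theorem from this prior and the likelihood) is an admissible solution of the inference problem, as is seen by taking the joint measure $P(\theta,\phi,x)=P(\theta,\phi)P(x|\theta,\phi)=P(h)P(x|\theta,\phi)$; (ii) moreover, any admissible solution $(R_x)_{x\in X}$ of the inference problem corresponds to a Bayesian solution, namely one using a prior $P(h)=P(\theta,\phi)$ that is the marginal on $\Theta\times\Phi$ of a joint measure $P(\theta,\phi,x)$ of the kind whose existence is required in the definition of an admissible solution. (There may be many such joint measures $P$ and many different such priors.)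
   Context: An inference problem consists of a wanted unknown $\theta$ in a set $\Theta$, an unwanted unknown $\phi$ in a set $\Phi$, observed data $x$ in a set $X$, a known probability distribution $P(x|\theta,\phi)$ of $x$ for each $(\theta,\phi)$ (the likelihood), and a subset $H\subseteq\Theta\times\Phi$ in which the actually occurring combinations $h=(\theta,\phi)$ are known to lie. An admissible solution is a family $(R_x)_{x\in X}$ of probability measures on $\Theta$ for which there exists a joint probability measure $P$ on $\Theta\times\Phi\times X$ such that (each condition being required only up to a set of $P$-probability zero): (Answer consistent) the induced conditional distribution on $\Theta$ given $x$ satisfies $P(\theta|x)=R_x(\theta)$; (Likelihood consistent) the induced conditional distribution $P(x|\theta,\phi)$ on $X$ equals the likelihood given in the problem; (Restriction consistent) the induced marginal distribution on $\Theta\times\Phi$ gives $P((\Theta\times\Phi)\setminus H)=0$; (Reality consistent) if there is further information known which tells us how likely each combination of values of $h=(\theta,\phi)$ is, then the induced distribution $P(\theta,\phi)$ is consistent with that information.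
   Formalization: In (i) the prior is also required to be consistent with the further information on how likely each h is, if there is any; without this the claim fails (e.g. the information fixes P(θ=0)=1/2 but the prior is concentrated on θ=0). With no further information nothing is added. *)

theory Defs
  imports "HOL-Probability.Probability"
begin

text \<open>
  The further information of the reality condition, if there is any, is represented by the set of
  all distributions of \<open>h = (\<theta>, \<phi>)\<close> consistent with it; \<open>None\<close> means that there is none.
\<close>

record ('t, 'f, 'x) inference_problem =
  Theta :: "'t measure"
  Phi :: "'f measure"
  Data :: "'x measure"
  likelihood :: "'t \<times> 'f \<Rightarrow> 'x measure"
  possible :: "('t \<times> 'f) set"
  information :: "('t \<times> 'f) measure set option"

abbreviation unknowns :: "('t, 'f, 'x) inference_problem \<Rightarrow> ('t \<times> 'f) measure" where
  "unknowns I \<equiv> Theta I \<Otimes>\<^sub>M Phi I"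

definition is_inference_problem :: "('t, 'f, 'x) inference_problem \<Rightarrow> bool" where
  "is_inference_problem I \<longleftrightarrow>
     likelihood I \<in> unknowns I \<rightarrow>\<^sub>M prob_algebra (Data I) \<and>
     possible I \<subseteq> space (unknowns I)"

text \<open>
  \<open>\<kappa>\<close> is a regular conditional distribution under \<open>P\<close> of \<open>Y\<close> (with values in \<open>N\<close>) given \<open>Z\<close>
  (with values in \<open>L\<close>): \<open>\<kappa> (Z w) A\<close> is a version of \<open>P(Y \<in> A | Z)\<close>.
\<close>

definition is_cond_distr ::
  "'w measure \<Rightarrow> 'y measure \<Rightarrow> ('w \<Rightarrow> 'y) \<Rightarrow> 'z measure \<Rightarrow> ('w \<Rightarrow> 'z) \<Rightarrow> ('z \<Rightarrow> 'y measure) \<Rightarrow> bool"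
  where
  "is_cond_distr P N Y L Z \<kappa> \<longleftrightarrow>
     \<kappa> \<in> L \<rightarrow>\<^sub>M prob_algebra N \<and>
     (\<forall>A\<in>sets N. AE w in P. measure (\<kappa> (Z w)) A =
        real_cond_exp P (vimage_algebra (space P) Z L) (indicat_real (Y -` A \<inter> space P)) w)"

definition prob_family :: "('t, 'f, 'x) inference_problem \<Rightarrow> ('x \<Rightarrow> 't measure) \<Rightarrow> bool" where
  "prob_family I R \<longleftrightarrow> (\<forall>x\<in>space (Data I). R x \<in> space (prob_algebra (Theta I)))"

text \<open>
  Joint measures live on \<open>(\<Theta> \<times> \<Phi>) \<times> X\<close>, so \<open>fst\<close> is \<open>h\<close>, \<open>fst \<circ> fst\<close> is \<open>\<theta>\<close> and \<open>snd\<close> is \<open>x\<close>.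
\<close>

definition unknowns_marginal ::
  "('t, 'f, 'x) inference_problem \<Rightarrow> (('t \<times> 'f) \<times> 'x) measure \<Rightarrow> ('t \<times> 'f) measure" where
  "unknowns_marginal I P = distr P (unknowns I) fst"

definition data_marginal ::
  "('t, 'f, 'x) inference_problem \<Rightarrow> (('t \<times> 'f) \<times> 'x) measure \<Rightarrow> 'x measure" where
  "data_marginal I P = distr P (Data I) snd"

definition answer_consistent ::
  "('t, 'f, 'x) inference_problem \<Rightarrow> ('x \<Rightarrow> 't measure) \<Rightarrow> (('t \<times> 'f) \<times> 'x) measure \<Rightarrow> bool" where
  "answer_consistent I R P \<longleftrightarrow>
     (\<exists>\<kappa>. is_cond_distr P (Theta I) (fst \<circ> fst) (Data I) snd \<kappa> \<and>
          (AE x in data_marginal I P. \<kappa> x = R x))"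

definition likelihood_consistent ::
  "('t, 'f, 'x) inference_problem \<Rightarrow> (('t \<times> 'f) \<times> 'x) measure \<Rightarrow> bool" where
  "likelihood_consistent I P \<longleftrightarrow>
     (\<exists>\<kappa>. is_cond_distr P (Data I) snd (unknowns I) fst \<kappa> \<and>
          (AE h in unknowns_marginal I P. \<kappa> h = likelihood I h))"

text \<open>
  Both support and information conditions are stated for a distribution of \<open>h\<close>, so that they apply
  to priors as well as to marginals of joint measures. As \<open>possible I\<close> need not be measurable,
  "probability zero" of its complement means being contained in a null set; note that
  \<open>emeasure\<close> of a non-measurable set is \<open>0\<close> by convention.
\<close>

definition concentrated_on_possible ::
  "('t, 'f, 'x) inference_problem \<Rightarrow> ('t \<times> 'f) measure \<Rightarrow> bool" where
  "concentrated_on_possible I \<pi> \<longleftrightarrow> (AE h in \<pi>. h \<in> possible I)"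

definition agrees_with_information ::
  "('t, 'f, 'x) inference_problem \<Rightarrow> ('t \<times> 'f) measure \<Rightarrow> bool" where
  "agrees_with_information I \<pi> \<longleftrightarrow>
     (case information I of None \<Rightarrow> True | Some J \<Rightarrow> \<pi> \<in> J)"

definition restriction_consistent ::
  "('t, 'f, 'x) inference_problem \<Rightarrow> (('t \<times> 'f) \<times> 'x) measure \<Rightarrow> bool" where
  "restriction_consistent I P \<longleftrightarrow> concentrated_on_possible I (unknowns_marginal I P)"

definition reality_consistent ::
  "('t, 'f, 'x) inference_problem \<Rightarrow> (('t \<times> 'f) \<times> 'x) measure \<Rightarrow> bool" where
  "reality_consistent I P \<longleftrightarrow> agrees_with_information I (unknowns_marginal I P)"

definition admissible_joint ::
  "('t, 'f, 'x) inference_problem \<Rightarrow> ('x \<Rightarrow> 't measure) \<Rightarrow> (('t \<times> 'f) \<times> 'x) measure \<Rightarrow> bool" where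
  "admissible_joint I R P \<longleftrightarrow>
     P \<in> space (prob_algebra (unknowns I \<Otimes>\<^sub>M Data I)) \<and>
     answer_consistent I R P \<and> likelihood_consistent I P \<and>
     restriction_consistent I P \<and> reality_consistent I P"

definition admissible_solution ::
  "('t, 'f, 'x) inference_problem \<Rightarrow> ('x \<Rightarrow> 't measure) \<Rightarrow> bool" where
  "admissible_solution I R \<longleftrightarrow> prob_family I R \<and> (\<exists>P. admissible_joint I R P)"

definition is_prior :: "('t, 'f, 'x) inference_problem \<Rightarrow> ('t \<times> 'f) measure \<Rightarrow> bool" where
  "is_prior I \<pi> \<longleftrightarrow> \<pi> \<in> space (prob_algebra (unknowns I)) \<and> concentrated_on_possible I \<pi>"

definition joint_measure ::
  "('t, 'f, 'x) inference_problem \<Rightarrow> ('t \<times> 'f) measure \<Rightarrow> (('t \<times> 'f) \<times> 'x) measure" where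
  "joint_measure I \<pi> =
     \<pi> \<bind> (\<lambda>h. likelihood I h \<bind> (\<lambda>x. return (unknowns I \<Otimes>\<^sub>M Data I) (h, x)))"

text \<open>
  Bayes' theorem for a likelihood that need not have densities: the posterior probability of
  \<open>\<theta> \<in> A\<close> is the ratio (Radon-Nikodym derivative) of \<open>P(\<theta> \<in> A, dx)\<close>, the integral of
  \<open>P(dx | h)\<close> over \<open>h \<in> A \<times> \<Phi>\<close> with respect to the prior, and the evidence \<open>P(dx)\<close>, the same
  integral over all \<open>h\<close>. Lemma \<open>bayes_formula\<close> below recovers the quotient for densities.
\<close>

definition evidence ::
  "('t, 'f, 'x) inference_problem \<Rightarrow> ('t \<times> 'f) measure \<Rightarrow> 'x measure" where
  "evidence I \<pi> = \<pi> \<bind> likelihood I"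

definition partial_evidence ::
  "('t, 'f, 'x) inference_problem \<Rightarrow> ('t \<times> 'f) measure \<Rightarrow> 't set \<Rightarrow> 'x measure" where
  "partial_evidence I \<pi> A = density \<pi> (indicator (A \<times> space (Phi I))) \<bind> likelihood I"

definition is_posterior ::
  "('t, 'f, 'x) inference_problem \<Rightarrow> ('t \<times> 'f) measure \<Rightarrow> ('x \<Rightarrow> 't measure) \<Rightarrow> bool" where
  "is_posterior I \<pi> \<kappa> \<longleftrightarrow>
     \<kappa> \<in> Data I \<rightarrow>\<^sub>M prob_algebra (Theta I) \<and>
     (\<forall>A\<in>sets (Theta I). AE x in evidence I \<pi>.
        emeasure (\<kappa> x) A = RN_deriv (evidence I \<pi>) (partial_evidence I \<pi> A) x)"

text \<open>Bayes' theorem determines the posterior only up to data of evidence zero.\<close>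

definition bayesian_solution ::
  "('t, 'f, 'x) inference_problem \<Rightarrow> ('t \<times> 'f) measure \<Rightarrow> ('x \<Rightarrow> 't measure) \<Rightarrow> bool" where
  "bayesian_solution I \<pi> R \<longleftrightarrow>
     prob_family I R \<and> (\<exists>\<kappa>. is_posterior I \<pi> \<kappa> \<and> (AE x in evidence I \<pi>. \<kappa> x = R x))"

lemma bayes_formula:
  fixes l :: "('t \<times> 'f) \<times> 'x \<Rightarrow> ennreal"
  assumes I: "is_inference_problem I" and pi: "is_prior I \<pi>"
    and mu: "sigma_finite_measure \<mu>" "sets \<mu> = sets (Data I)"
    and l: "l \<in> borel_measurable (unknowns I \<Otimes>\<^sub>M \<mu>)"
    and dens: "\<And>h. h \<in> space (unknowns I) \<Longrightarrow> likelihood I h = density \<mu> (\<lambda>x. l (h, x))"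
    and kernel: "\<kappa> \<in> Data I \<rightarrow>\<^sub>M prob_algebra (Theta I)"
    and bayes: "\<And>A. A \<in> sets (Theta I) \<Longrightarrow> AE x in evidence I \<pi>.
      emeasure (\<kappa> x) A =
        (\<integral>\<^sup>+h. indicator (A \<times> space (Phi I)) h * l (h, x) \<partial>\<pi>) / (\<integral>\<^sup>+h. l (h, x) \<partial>\<pi>)"
  shows "is_posterior I \<pi> \<kappa>"
proof -
  interpret mu: sigma_finite_measure \<mu> by fact
  have spi: "sets \<pi> = sets (unknowns I)" and "prob_space \<pi>"
    using pi by (auto simp: is_prior_def space_prob_algebra)
  interpret pi: prob_space \<pi> by fact
  interpret pm: pair_sigma_finite \<pi> \<mu> ..
  have K: "likelihood I \<in> unknowns I \<rightarrow>\<^sub>M prob_algebra (Data I)"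
    using I by (simp add: is_inference_problem_def)
  have Ks: "likelihood I \<in> unknowns I \<rightarrow>\<^sub>M subprob_algebra (Data I)"
    using K by (rule measurable_prob_algebraD)
  have sp: "space \<pi> = space (unknowns I)" and smu: "space \<mu> = space (Data I)"
    using spi mu(2) by (auto dest: sets_eq_imp_space_eq)
  have lm[measurable]: "l \<in> borel_measurable (\<pi> \<Otimes>\<^sub>M \<mu>)"
    using l by (simp cong: measurable_cong_sets sets_pair_measure_cong add: spi)
  define Z where "Z x = (\<integral>\<^sup>+h. l (h, x) \<partial>\<pi>)" for x
  define n where "n A x = (\<integral>\<^sup>+h. indicator (A \<times> space (Phi I)) h * l (h, x) \<partial>\<pi>)" for A x
  have AP[measurable]: "A \<times> space (Phi I) \<in> sets \<pi>" if "A \<in> sets (Theta I)" for A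
    using that by (auto simp: spi)
  have Zm[measurable]: "Z \<in> borel_measurable \<mu>"
    unfolding Z_def by measurable
  have nm[measurable]: "n A \<in> borel_measurable \<mu>" if "A \<in> sets (Theta I)" for A
    using AP[OF that] unfolding n_def by measurable
  have general: "density \<pi> f \<bind> likelihood I = density \<mu> (\<lambda>x. \<integral>\<^sup>+h. f h * l (h, x) \<partial>\<pi>)"
    if f[measurable]: "f \<in> borel_measurable \<pi>" for f
  proof (rule measure_eqI)
    have ne: "space (density \<pi> f) \<noteq> {}" using pi.not_empty by simp
    have Kd: "likelihood I \<in> density \<pi> f \<rightarrow>\<^sub>M subprob_algebra (Data I)"
      using Ks by (simp cong: measurable_cong_sets add: spi)
    have Kpi: "likelihood I \<in> \<pi> \<rightarrow>\<^sub>M subprob_algebra (Data I)"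
      using Ks by (simp cong: measurable_cong_sets add: spi)
    have sb: "sets (density \<pi> f \<bind> likelihood I) = sets (Data I)"
      by (rule sets_bind[OF sets_kernel[OF Kd] ne])
    then show "sets (density \<pi> f \<bind> likelihood I) = sets (density \<mu> (\<lambda>x. \<integral>\<^sup>+h. f h * l (h, x) \<partial>\<pi>))"
      using mu by simp
    fix B assume "B \<in> sets (density \<pi> f \<bind> likelihood I)"
    then have B: "B \<in> sets (Data I)" and [measurable]: "B \<in> sets \<mu>" using sb mu by auto
    have em: "(\<lambda>h. emeasure (likelihood I h) B) \<in> borel_measurable \<pi>"
      by (rule measurable_emeasure_kernel[OF Kpi B])
    have "emeasure (density \<pi> f \<bind> likelihood I) B
        = (\<integral>\<^sup>+h. emeasure (likelihood I h) B \<partial>density \<pi> f)"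
      by (rule emeasure_bind[OF ne Kd B])
    also have "\<dots> = (\<integral>\<^sup>+h. f h * emeasure (likelihood I h) B \<partial>\<pi>)"
      by (rule nn_integral_density[OF f em])
    also have "\<dots> = (\<integral>\<^sup>+h. (\<integral>\<^sup>+x. f h * (l (h, x) * indicator B x) \<partial>\<mu>) \<partial>\<pi>)"
    proof (rule nn_integral_cong)
      fix h assume h: "h \<in> space \<pi>"
      then have [measurable]: "(\<lambda>x. l (h, x)) \<in> borel_measurable \<mu>" by measurable
      show "f h * emeasure (likelihood I h) B = (\<integral>\<^sup>+x. f h * (l (h, x) * indicator B x) \<partial>\<mu>)"
        using h by (simp add: dens sp emeasure_density nn_integral_cmult)
    qed
    also have "\<dots> = (\<integral>\<^sup>+x. (\<integral>\<^sup>+h. f h * (l (h, x) * indicator B x) \<partial>\<pi>) \<partial>\<mu>)"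
      by (rule pm.Fubini'[symmetric]) measurable
    also have "\<dots> = (\<integral>\<^sup>+x. (\<integral>\<^sup>+h. f h * l (h, x) \<partial>\<pi>) * indicator B x \<partial>\<mu>)"
      by (intro nn_integral_cong) (auto simp: indicator_def)
    also have "\<dots> = emeasure (density \<mu> (\<lambda>x. \<integral>\<^sup>+h. f h * l (h, x) \<partial>\<pi>)) B"
      by (subst emeasure_density) auto
    finally show "emeasure (density \<pi> f \<bind> likelihood I) B
        = emeasure (density \<mu> (\<lambda>x. \<integral>\<^sup>+h. f h * l (h, x) \<partial>\<pi>)) B" .
  qed
  have ev: "evidence I \<pi> = density \<mu> Z"
    using general[of "\<lambda>_. 1"] by (simp add: evidence_def Z_def[abs_def] density_1)
  have pev: "partial_evidence I \<pi> A = density \<mu> (n A)" if "A \<in> sets (Theta I)" for A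
    using general[of "indicator (A \<times> space (Phi I))"] AP[OF that]
    by (simp add: partial_evidence_def n_def[abs_def])
  have Kp: "likelihood I \<in> \<pi> \<rightarrow>\<^sub>M prob_algebra (Data I)"
    using K by (simp cong: measurable_cong_sets add: spi)
  have "prob_space (evidence I \<pi>)"
    unfolding evidence_def
    by (rule prob_space_bind'[OF _ Kp]) (simp add: space_prob_algebra pi.prob_space_axioms)
  then interpret ev: prob_space "evidence I \<pi>" .
  have "(\<integral>\<^sup>+x. Z x \<partial>\<mu>) = 1"
    using ev.emeasure_space_1 by (simp add: ev emeasure_density cong: nn_integral_cong)
  then have Zfin: "AE x in \<mu>. Z x \<noteq> \<infinity>"
    by (intro nn_integral_noteq_infinite) auto
  show ?thesis
    unfolding is_posterior_def
  proof (intro conjI ballI kernel)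
    fix A assume A: "A \<in> sets (Theta I)"
    note [measurable] = nm[OF A]
    have le: "n A x \<le> Z x" for x
      unfolding n_def Z_def by (intro nn_integral_mono) (auto simp: indicator_def)
    have "density (evidence I \<pi>) (\<lambda>x. n A x / Z x) = density \<mu> (\<lambda>x. Z x * (n A x / Z x))"
      unfolding ev by (rule density_density_eq) measurable
    also have "\<dots> = density \<mu> (n A)"
    proof (rule density_cong)
      show "AE x in \<mu>. Z x * (n A x / Z x) = n A x"
        using Zfin
      proof eventually_elim
        case (elim x)
        show ?case
        proof (cases "Z x = 0")
          case True then show ?thesis using le[of x] by simp
        next
          case False
          with elim show ?thesis
            by (metis ennreal_mult_divide_eq ennreal_times_divide infinity_ennreal_def mult.commute)
        qed
      qed
    qed measurable
    finally have eq: "density (evidence I \<pi>) (\<lambda>x. n A x / Z x) = partial_evidence I \<pi> A"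
      by (simp add: pev[OF A])
    have "AE x in evidence I \<pi>. n A x / Z x = RN_deriv (evidence I \<pi>) (partial_evidence I \<pi> A) x"
      by (rule ev.RN_deriv_unique[OF _ eq]) (simp add: ev)
    with bayes[OF A] show "AE x in evidence I \<pi>.
        emeasure (\<kappa> x) A = RN_deriv (evidence I \<pi>) (partial_evidence I \<pi> A) x"
      unfolding n_def[symmetric] Z_def[symmetric] by eventually_elim simp
  qed
qed

end

theory Submission
  imports Defs
begin

text \<open>
  Both directions rest on two equivalences about a joint measure \<open>P\<close>, each obtained by testing
  measures on rectangles.

  First, \<open>P\<close> has the given likelihood as its conditional distribution of \<open>x\<close> given \<open>h\<close> iff
  \<open>P(C \<times> B)\<close> is the integral of \<open>P(B | h)\<close> over \<open>h \<in> C\<close> with respect to the marginal of \<open>P\<close> on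
  \<open>h\<close>. Rectangles generate the product \<open>\<sigma>\<close>-algebra, so this says that \<open>P\<close> is the product of its own
  marginal and the likelihood (\<open>likelihood_consistent_iff_joint_measure\<close>). Every admissible joint
  measure therefore is the joint measure of a prior, and that prior can only be its marginal.

  Secondly, let \<open>P\<close> be the joint measure of a prior. Its data marginal is the evidence, and
  \<open>P((A \<times> \<Phi>) \<times> B)\<close> is the mass that the partial evidence of \<open>A\<close> gives to \<open>B\<close>. A kernel \<open>\<kappa>\<close> is a
  conditional distribution of \<open>\<theta>\<close> given \<open>x\<close> iff, for each \<open>A\<close>, the function \<open>x \<mapsto> \<kappa> x A\<close> is
  a density of the partial evidence of \<open>A\<close> relative to the evidence. This is exactly Bayes' theorem
  in Radon-Nikodym form (\<open>is_posterior_iff_is_cond_distr\<close>), so the Bayesian solutions for a prior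
  are the probability families consistent, as answers, with its joint measure.

  Support and information conditions only concern the marginal on \<open>h\<close>, and the joint measure of a
  prior has that prior as its marginal (\<open>unknowns_marginal_joint_measure\<close>).
\<close>

section \<open>Regular conditional distributions\<close>

text \<open>
  Conditional expectations given \<open>Z\<close> are characterized by their integrals over the sets
  \<open>Z -` B\<close>. Pushing these integrals forward along \<open>Z\<close> removes the conditional expectation
  and leaves identities between measures of rectangles.
\<close>

lemma is_cond_distr_iff_nn_integral:
  assumes P: "prob_space P"
    and Y[measurable]: "Y \<in> P \<rightarrow>\<^sub>M N" and Z[measurable]: "Z \<in> P \<rightarrow>\<^sub>M L"
    and \<kappa>: "\<kappa> \<in> L \<rightarrow>\<^sub>M prob_algebra N"
  shows "is_cond_distr P N Y L Z \<kappa> \<longleftrightarrow>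
    (\<forall>A\<in>sets N. \<forall>B\<in>sets L. (\<integral>\<^sup>+z. emeasure (\<kappa> z) A * indicator B z \<partial>distr P L Z)
        = emeasure P (Y -` A \<inter> Z -` B \<inter> space P))"
proof -
  interpret prob_space P by fact
  define F where "F = vimage_algebra (space P) Z L"
  have ZF: "Z \<in> space P \<rightarrow> space L"
    using measurable_space[OF Z] by auto
  have sets_F: "sets F = (\<lambda>B. Z -` B \<inter> space P) ` sets L"
    unfolding F_def sets_vimage_algebra2[OF ZF] by auto
  have Z_F[measurable]: "Z \<in> F \<rightarrow>\<^sub>M L"
    unfolding F_def by (rule measurable_vimage_algebra1[OF ZF])
  have "subalgebra P F"
    unfolding subalgebra_def sets_F by (auto simp: F_def)
  then interpret F: finite_measure_subalgebra P F
    by unfold_locales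
  have \<kappa>_subprob: "\<kappa> \<in> L \<rightarrow>\<^sub>M subprob_algebra N"
    using \<kappa> by (rule measurable_prob_algebraD)
  have "(AE w in P. measure (\<kappa> (Z w)) A = real_cond_exp P F (indicat_real (Y -` A \<inter> space P)) w) \<longleftrightarrow>
      (\<forall>B\<in>sets L. (\<integral>\<^sup>+z. emeasure (\<kappa> z) A * indicator B z \<partial>distr P L Z)
        = emeasure P (Y -` A \<inter> Z -` B \<inter> space P))" (is "?ae \<longleftrightarrow> ?int")
    if A[measurable]: "A \<in> sets N" for A
  proof -
    define f where "f = indicat_real (Y -` A \<inter> space P)"
    define g where "g w = measure (\<kappa> (Z w)) A" for w
    have prob_\<kappa>: "prob_space (\<kappa> z)" if "z \<in> space L" for z
      using measurable_space[OF \<kappa> that] by (simp add: space_prob_algebra)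
    have [measurable]: "(\<lambda>z. measure (\<kappa> z) A) \<in> borel_measurable L"
      using \<kappa> by (rule measurable_compose) (rule measurable_measure_prob_algebra[OF A])
    have gF[measurable]: "g \<in> borel_measurable F" and gP[measurable]: "g \<in> borel_measurable P"
      unfolding g_def by measurable
    have g_bounds: "0 \<le> g w" "g w \<le> 1" if "w \<in> space P" for w
      using prob_\<kappa>[OF measurable_space[OF Z that]] by (auto simp: g_def prob_space.prob_le_1)
    have f_int: "integrable P f"
      unfolding f_def by (intro integrable_real_indicator) (auto simp: emeasure_eq_measure)
    have g_int: "integrable P g"
      by (rule integrable_const_bound[where B=1]) (use g_bounds in \<open>auto intro!: AE_I2\<close>)
    have kernel_side: "(\<integral>\<^sup>+z. emeasure (\<kappa> z) A * indicator B z \<partial>distr P L Z)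
        = ennreal (\<integral>w\<in>Z -` B \<inter> space P. g w \<partial>P)" if B[measurable]: "B \<in> sets L" for B
    proof -
      have [measurable]: "(\<lambda>z. emeasure (\<kappa> z) A) \<in> borel_measurable L"
        using measurable_emeasure_kernel[OF \<kappa>_subprob A] .
      have "(\<integral>\<^sup>+z. emeasure (\<kappa> z) A * indicator B z \<partial>distr P L Z)
          = (\<integral>\<^sup>+w. emeasure (\<kappa> (Z w)) A * indicator B (Z w) \<partial>P)"
        by (rule nn_integral_distr) measurable
      also have "\<dots> = (\<integral>\<^sup>+w. ennreal (indicator (Z -` B \<inter> space P) w * g w) \<partial>P)"
      proof (rule nn_integral_cong)
        fix w assume w: "w \<in> space P"
        interpret k: prob_space "\<kappa> (Z w)"
          using prob_\<kappa>[OF measurable_space[OF Z w]] .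
        show "emeasure (\<kappa> (Z w)) A * indicator B (Z w)
            = ennreal (indicator (Z -` B \<inter> space P) w * g w)"
          using w by (auto simp: g_def k.emeasure_eq_measure indicator_def)
      qed
      also have "\<dots> = ennreal (\<integral>w. indicator (Z -` B \<inter> space P) w * g w \<partial>P)"
      proof (rule nn_integral_eq_integral)
        show "integrable P (\<lambda>w. indicator (Z -` B \<inter> space P) w * g w)"
          using integrable_mult_indicator[OF _ g_int, of "Z -` B \<inter> space P"] by simp
      qed (use g_bounds in \<open>auto intro!: AE_I2 simp: indicator_def\<close>)
      finally show ?thesis by (simp add: set_lebesgue_integral_def)
    qed
    have joint_side: "emeasure P (Y -` A \<inter> Z -` B \<inter> space P)
        = ennreal (\<integral>w\<in>Z -` B \<inter> space P. f w \<partial>P)" if B[measurable]: "B \<in> sets L" for B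
    proof -
      have "(\<integral>w\<in>Z -` B \<inter> space P. f w \<partial>P) = (\<integral>w. indicat_real (Y -` A \<inter> Z -` B \<inter> space P) w \<partial>P)"
        unfolding set_lebesgue_integral_def f_def
        by (intro Bochner_Integration.integral_cong) (auto simp: indicator_def)
      also have "\<dots> = measure P (Y -` A \<inter> Z -` B \<inter> space P)"
        by (simp add: Int_assoc)
      finally show ?thesis by (simp add: emeasure_eq_measure)
    qed
    have nonneg: "0 \<le> (\<integral>w\<in>C. g w \<partial>P)" "0 \<le> (\<integral>w\<in>C. f w \<partial>P)" for C
      unfolding set_lebesgue_integral_def f_def
      by (auto intro!: Bochner_Integration.integral_nonneg simp: g_bounds)
    have "?int \<longleftrightarrow> (\<forall>B\<in>sets L. (\<integral>w\<in>Z -` B \<inter> space P. g w \<partial>P) = (\<integral>w\<in>Z -` B \<inter> space P. f w \<partial>P))"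
      using nonneg by (simp add: kernel_side joint_side)
    also have "\<dots> \<longleftrightarrow> (\<forall>C\<in>sets F. (\<integral>w\<in>C. g w \<partial>P) = (\<integral>w\<in>C. f w \<partial>P))"
      unfolding sets_F by simp
    also have "\<dots> \<longleftrightarrow> (AE w in P. g w = real_cond_exp P F f w)"
    proof
      assume "\<forall>C\<in>sets F. (\<integral>w\<in>C. g w \<partial>P) = (\<integral>w\<in>C. f w \<partial>P)"
      then have "AE w in P. real_cond_exp P F f w = g w"
        by (intro F.real_cond_exp_charact f_int g_int gF) auto
      then show "AE w in P. g w = real_cond_exp P F f w" by eventually_elim simp
    next
      assume ae: "AE w in P. g w = real_cond_exp P F f w"
      show "\<forall>C\<in>sets F. (\<integral>w\<in>C. g w \<partial>P) = (\<integral>w\<in>C. f w \<partial>P)"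
      proof
        fix C assume C: "C \<in> sets F"
        then have [measurable]: "C \<in> sets P"
          using F.subalg by (auto simp: subalgebra_def)
        have "(\<integral>w\<in>C. f w \<partial>P) = (\<integral>w\<in>C. real_cond_exp P F f w \<partial>P)"
          by (rule F.real_cond_exp_intA[OF f_int C])
        also have "\<dots> = (\<integral>w\<in>C. g w \<partial>P)"
          unfolding set_lebesgue_integral_def
          by (rule integral_cong_AE) (use ae in auto)
        finally show "(\<integral>w\<in>C. g w \<partial>P) = (\<integral>w\<in>C. f w \<partial>P)" by (rule sym)
      qed
    qed
    finally show ?thesis by (simp add: f_def g_def)
  qed
  then show ?thesis
    using \<kappa> by (simp add: is_cond_distr_def F_def)
qed

text \<open>
  Absolute continuity matters for the direction from left to right: it is what makes
  \<open>RN_deriv M N\<close> an actual density of \<open>N\<close> rather than a default value.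
\<close>

lemma (in sigma_finite_measure) AE_eq_RN_deriv_iff:
  assumes "absolutely_continuous M N" "sets N = sets M" and [measurable]: "f \<in> borel_measurable M"
  shows "(AE x in M. f x = RN_deriv M N x) \<longleftrightarrow> density M f = N"
proof
  assume "AE x in M. f x = RN_deriv M N x"
  then have "density M f = density M (RN_deriv M N)"
    by (intro density_cong) auto
  with assms(1,2) show "density M f = N" by (simp add: density_RN_deriv)
qed (rule RN_deriv_unique[OF assms(3)])

section \<open>The joint measure of a prior and a likelihood\<close>

context
  fixes I :: "('t, 'f, 'x) inference_problem" and \<pi> :: "('t \<times> 'f) measure"
  assumes I: "is_inference_problem I"
    and \<pi>: "\<pi> \<in> space (prob_algebra (unknowns I))"
begin

lemma likelihood_kernel:
  "likelihood I \<in> unknowns I \<rightarrow>\<^sub>M prob_algebra (Data I)"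
  using I by (simp add: is_inference_problem_def)

lemma sets_prior: "sets \<pi> = sets (unknowns I)"
  and space_prior: "space \<pi> = space (unknowns I)"
  and prob_space_prior: "prob_space \<pi>"
  using \<pi> by (auto simp: space_prob_algebra dest: sets_eq_imp_space_eq)

lemma joint_kernel:
  "(\<lambda>h. likelihood I h \<bind> (\<lambda>x. return (unknowns I \<Otimes>\<^sub>M Data I) (h, x)))
     \<in> unknowns I \<rightarrow>\<^sub>M prob_algebra (unknowns I \<Otimes>\<^sub>M Data I)"
proof (rule measurable_bind_prob_space2[OF likelihood_kernel])
  have "(\<lambda>(h, x). return (unknowns I \<Otimes>\<^sub>M Data I) (h, x)) = return (unknowns I \<Otimes>\<^sub>M Data I)"
    by auto
  then show "(\<lambda>(h, x). return (unknowns I \<Otimes>\<^sub>M Data I) (h, x))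
      \<in> unknowns I \<Otimes>\<^sub>M Data I \<rightarrow>\<^sub>M prob_algebra (unknowns I \<Otimes>\<^sub>M Data I)"
    by simp
qed

lemma joint_measure_in_prob_algebra:
  "joint_measure I \<pi> \<in> space (prob_algebra (unknowns I \<Otimes>\<^sub>M Data I))"
  unfolding joint_measure_def
  using prob_space_bind'[OF \<pi> joint_kernel] sets_bind'[OF \<pi> joint_kernel]
  by (simp add: space_prob_algebra)

text \<open>
  Given \<open>h\<close>, the pair \<open>(h, x)\<close> is the image of \<open>x\<close> under \<open>Pair h\<close>, and the section of
  \<open>C \<times> B\<close> at \<open>h\<close> is \<open>B\<close> or empty according to whether \<open>h \<in> C\<close>.
\<close>

lemma emeasure_joint_measure_Times:
  assumes C: "C \<in> sets (unknowns I)" and B: "B \<in> sets (Data I)"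
  shows "emeasure (joint_measure I \<pi>) (C \<times> B)
    = (\<integral>\<^sup>+h. emeasure (likelihood I h) B * indicator C h \<partial>\<pi>)"
proof -
  have "emeasure (joint_measure I \<pi>) (C \<times> B)
    = (\<integral>\<^sup>+h. emeasure (likelihood I h \<bind> (\<lambda>x. return (unknowns I \<Otimes>\<^sub>M Data I) (h, x))) (C \<times> B) \<partial>\<pi>)"
    unfolding joint_measure_def using C B
    by (intro emeasure_bind_prob_algebra[OF \<pi> joint_kernel]) auto
  also have "\<dots> = (\<integral>\<^sup>+h. emeasure (likelihood I h) B * indicator C h \<partial>\<pi>)"
  proof (rule nn_integral_cong)
    fix h assume "h \<in> space \<pi>"
    then have h: "h \<in> space (unknowns I)" by (simp add: space_prior)
    have lik: "sets (likelihood I h) = sets (Data I)" "prob_space (likelihood I h)"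
      using measurable_space[OF likelihood_kernel h] by (auto simp: space_prob_algebra)
    have pair: "Pair h \<in> likelihood I h \<rightarrow>\<^sub>M unknowns I \<Otimes>\<^sub>M Data I"
      using h by (simp add: measurable_cong_sets[OF lik(1) refl])
    have "likelihood I h \<bind> (\<lambda>x. return (unknowns I \<Otimes>\<^sub>M Data I) (h, x))
        = distr (likelihood I h) (unknowns I \<Otimes>\<^sub>M Data I) (Pair h)"
      by (rule bind_return_distr'[OF prob_space.not_empty[OF lik(2)] pair])
    moreover have "emeasure (distr (likelihood I h) (unknowns I \<Otimes>\<^sub>M Data I) (Pair h)) (C \<times> B)
        = emeasure (likelihood I h) (Pair h -` (C \<times> B) \<inter> space (likelihood I h))"
      using C B by (intro emeasure_distr pair) auto
    moreover have "Pair h -` (C \<times> B) \<inter> space (likelihood I h) = (if h \<in> C then B else {})"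
      using sets.sets_into_space[of B "likelihood I h"] B lik(1) by auto
    ultimately show "emeasure (likelihood I h \<bind> (\<lambda>x. return (unknowns I \<Otimes>\<^sub>M Data I) (h, x))) (C \<times> B)
        = emeasure (likelihood I h) B * indicator C h"
      by simp
  qed
  finally show ?thesis .
qed

lemma unknowns_marginal_joint_measure: "unknowns_marginal I (joint_measure I \<pi>) = \<pi>"
proof (rule measure_eqI)
  have sets_J: "sets (joint_measure I \<pi>) = sets (unknowns I \<Otimes>\<^sub>M Data I)"
    using joint_measure_in_prob_algebra by (simp add: space_prob_algebra)
  show "sets (unknowns_marginal I (joint_measure I \<pi>)) = sets \<pi>"
    by (simp add: unknowns_marginal_def sets_prior)
  fix C assume "C \<in> sets (unknowns_marginal I (joint_measure I \<pi>))"
  then have C: "C \<in> sets (unknowns I)" by (simp add: unknowns_marginal_def)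
  have "fst \<in> joint_measure I \<pi> \<rightarrow>\<^sub>M unknowns I"
    by (simp add: measurable_cong_sets[OF sets_J refl])
  then have "emeasure (unknowns_marginal I (joint_measure I \<pi>)) C
      = emeasure (joint_measure I \<pi>) (C \<times> space (Data I))"
    using sets.sets_into_space[OF C] C
    by (auto simp: unknowns_marginal_def emeasure_distr sets_eq_imp_space_eq[OF sets_J] space_pair_measure
        intro!: arg_cong[where f="emeasure (joint_measure I \<pi>)"])
  also have "\<dots> = (\<integral>\<^sup>+h. emeasure (likelihood I h) (space (Data I)) * indicator C h \<partial>\<pi>)"
    using C by (simp add: emeasure_joint_measure_Times)
  also have "\<dots> = (\<integral>\<^sup>+h. indicator C h \<partial>\<pi>)"
  proof (rule nn_integral_cong)
    fix h assume "h \<in> space \<pi>"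
    then have "likelihood I h \<in> space (prob_algebra (Data I))"
      by (intro measurable_space[OF likelihood_kernel]) (simp add: space_prior)
    then have "sets (likelihood I h) = sets (Data I)" "prob_space (likelihood I h)"
      by (auto simp: space_prob_algebra)
    then have "emeasure (likelihood I h) (space (Data I)) = 1"
      using prob_space.emeasure_space_1 sets_eq_imp_space_eq by metis
    then show "emeasure (likelihood I h) (space (Data I)) * indicator C h = indicator C h"
      by simp
  qed
  also have "\<dots> = emeasure \<pi> C"
    using C by (simp add: sets_prior)
  finally show "emeasure (unknowns_marginal I (joint_measure I \<pi>)) C = emeasure \<pi> C" .
qed

lemma emeasure_partial_evidence:
  assumes A: "A \<in> sets (Theta I)" and B: "B \<in> sets (Data I)"
  shows "emeasure (partial_evidence I \<pi> A) B = emeasure (joint_measure I \<pi>) ((A \<times> space (Phi I)) \<times> B)"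
proof -
  let ?C = "A \<times> space (Phi I)"
  have C: "?C \<in> sets (unknowns I)" using A by simp
  then have ind: "indicator ?C \<in> borel_measurable \<pi>"
    by (intro borel_measurable_indicator) (simp only: sets_prior)
  have lik: "likelihood I \<in> \<pi> \<rightarrow>\<^sub>M subprob_algebra (Data I)"
    using measurable_prob_algebraD[OF likelihood_kernel]
    by (simp cong: measurable_cong_sets add: sets_prior)
  have "emeasure (partial_evidence I \<pi> A) B
      = (\<integral>\<^sup>+h. emeasure (likelihood I h) B \<partial>density \<pi> (indicator ?C))"
    unfolding partial_evidence_def
    by (rule emeasure_bind[OF _ _ B])
      (use lik prob_space.not_empty[OF prob_space_prior] in \<open>auto cong: measurable_cong_sets\<close>)
  also have "\<dots> = (\<integral>\<^sup>+h. indicator ?C h * emeasure (likelihood I h) B \<partial>\<pi>)"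
    by (rule nn_integral_density[OF ind measurable_emeasure_kernel[OF lik B]])
  finally show ?thesis
    by (simp add: emeasure_joint_measure_Times[OF C B] mult.commute)
qed

lemma data_marginal_joint_measure: "data_marginal I (joint_measure I \<pi>) = evidence I \<pi>"
proof (rule measure_eqI)
  have sets_J: "sets (joint_measure I \<pi>) = sets (unknowns I \<Otimes>\<^sub>M Data I)"
    using joint_measure_in_prob_algebra by (simp add: space_prob_algebra)
  show "sets (data_marginal I (joint_measure I \<pi>)) = sets (evidence I \<pi>)"
    by (simp add: data_marginal_def evidence_def sets_bind'[OF \<pi> likelihood_kernel])
  fix B assume "B \<in> sets (data_marginal I (joint_measure I \<pi>))"
  then have B: "B \<in> sets (Data I)" by (simp add: data_marginal_def)
  have "snd \<in> joint_measure I \<pi> \<rightarrow>\<^sub>M Data I"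
    by (simp add: measurable_cong_sets[OF sets_J refl])
  then have "emeasure (data_marginal I (joint_measure I \<pi>)) B
      = emeasure (joint_measure I \<pi>) (space (unknowns I) \<times> B)"
    using sets.sets_into_space[OF B] B
    by (auto simp: data_marginal_def emeasure_distr sets_eq_imp_space_eq[OF sets_J] space_pair_measure
        intro!: arg_cong[where f="emeasure (joint_measure I \<pi>)"])
  also have "\<dots> = (\<integral>\<^sup>+h. emeasure (likelihood I h) B \<partial>\<pi>)"
    unfolding emeasure_joint_measure_Times[OF sets.top B]
    by (rule nn_integral_cong) (simp add: space_prior)
  also have "\<dots> = emeasure (evidence I \<pi>) B"
    by (simp add: evidence_def emeasure_bind_prob_algebra[OF \<pi> likelihood_kernel B])
  finally show "emeasure (data_marginal I (joint_measure I \<pi>)) B = emeasure (evidence I \<pi>) B" .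
qed

text \<open>
  Bayes' theorem. The partial evidence of \<open>A\<close> is dominated by the evidence, so the Radon-Nikodym
  condition on \<open>\<kappa>\<close> can be integrated over sets of data; the result is the characterization of
  conditional distributions by rectangles.
\<close>

lemma is_posterior_iff_is_cond_distr:
  "is_posterior I \<pi> \<kappa> \<longleftrightarrow>
    is_cond_distr (joint_measure I \<pi>) (Theta I) (fst \<circ> fst) (Data I) snd \<kappa>"
proof (cases "\<kappa> \<in> Data I \<rightarrow>\<^sub>M prob_algebra (Theta I)")
  case False
  then show ?thesis by (simp add: is_posterior_def is_cond_distr_def)
next
  case True
  let ?J = "joint_measure I \<pi>" and ?E = "evidence I \<pi>"
  have sets_J: "sets ?J = sets (unknowns I \<Otimes>\<^sub>M Data I)" and J: "prob_space ?J"
    using joint_measure_in_prob_algebra by (auto simp: space_prob_algebra)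
  have sets_E: "sets ?E = sets (Data I)"
    unfolding evidence_def by (rule sets_bind'[OF \<pi> likelihood_kernel])
  interpret E: prob_space ?E
    unfolding evidence_def by (rule prob_space_bind'[OF \<pi> likelihood_kernel])
  have "(AE x in ?E. emeasure (\<kappa> x) A = RN_deriv ?E (partial_evidence I \<pi> A) x) \<longleftrightarrow>
      (\<forall>B\<in>sets (Data I). (\<integral>\<^sup>+x. emeasure (\<kappa> x) A * indicator B x \<partial>?E)
        = emeasure ?J ((A \<times> space (Phi I)) \<times> B))" if A: "A \<in> sets (Theta I)" for A
  proof -
    let ?N = "partial_evidence I \<pi> A"
    have sets_N: "sets ?N = sets ?E"
      unfolding partial_evidence_def sets_E
      using sets_kernel[OF measurable_prob_algebraD[OF likelihood_kernel]]
        prob_space.not_empty[OF prob_space_prior]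
      by (intro sets_bind) (auto simp: space_prior)
    have \<kappa>_A[measurable]: "(\<lambda>x. emeasure (\<kappa> x) A) \<in> borel_measurable ?E"
      using measurable_emeasure_kernel[OF measurable_prob_algebraD[OF True] A]
      by (simp cong: measurable_cong_sets add: sets_E)
    have N_le_E: "emeasure ?N B \<le> emeasure ?E B" if B: "B \<in> sets (Data I)" for B
    proof -
      have "emeasure ?N B \<le> (\<integral>\<^sup>+h. emeasure (likelihood I h) B \<partial>\<pi>)"
        using A B by (simp add: emeasure_partial_evidence emeasure_joint_measure_Times)
          (auto intro!: nn_integral_mono simp: indicator_def)
      then show ?thesis
        by (simp add: evidence_def emeasure_bind_prob_algebra[OF \<pi> likelihood_kernel B])
    qed
    have "absolutely_continuous ?E ?N"
      unfolding absolutely_continuous_def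
    proof
      fix B assume "B \<in> null_sets ?E"
      then show "B \<in> null_sets ?N"
        using N_le_E[of B] by (auto simp: null_sets_def sets_N sets_E)
    qed
    then have "(AE x in ?E. emeasure (\<kappa> x) A = RN_deriv ?E ?N x) \<longleftrightarrow>
        density ?E (\<lambda>x. emeasure (\<kappa> x) A) = ?N"
      by (rule E.AE_eq_RN_deriv_iff[OF _ sets_N \<kappa>_A])
    also have "\<dots> \<longleftrightarrow> (\<forall>B\<in>sets (Data I).
        emeasure (density ?E (\<lambda>x. emeasure (\<kappa> x) A)) B = emeasure ?N B)"
      using sets_N sets_E by (auto intro!: measure_eqI)
    finally show ?thesis
      using A by (simp add: emeasure_density sets_E emeasure_partial_evidence)
  qed
  moreover have "(fst \<circ> fst) -` A \<inter> snd -` B \<inter> space ?J = (A \<times> space (Phi I)) \<times> B"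
    if "A \<in> sets (Theta I)" "B \<in> sets (Data I)" for A B
    using that[THEN sets.sets_into_space]
    by (auto simp: sets_eq_imp_space_eq[OF sets_J] space_pair_measure)
  moreover have "is_cond_distr ?J (Theta I) (fst \<circ> fst) (Data I) snd \<kappa> \<longleftrightarrow>
      (\<forall>A\<in>sets (Theta I). \<forall>B\<in>sets (Data I).
        (\<integral>\<^sup>+x. emeasure (\<kappa> x) A * indicator B x \<partial>distr ?J (Data I) snd)
          = emeasure ?J ((fst \<circ> fst) -` A \<inter> snd -` B \<inter> space ?J))"
    by (rule is_cond_distr_iff_nn_integral[OF J _ _ True])
      (simp_all cong: measurable_cong_sets add: sets_J)
  ultimately show ?thesis
    using True by (simp add: is_posterior_def data_marginal_joint_measure[unfolded data_marginal_def])
qed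

lemma bayesian_solution_iff_answer_consistent:
  "bayesian_solution I \<pi> R \<longleftrightarrow> prob_family I R \<and> answer_consistent I R (joint_measure I \<pi>)"
  unfolding bayesian_solution_def answer_consistent_def is_posterior_iff_is_cond_distr
    data_marginal_joint_measure ..

end

section \<open>Likelihood consistency\<close>

lemma unknowns_marginal_in_prob_algebra:
  assumes "P \<in> space (prob_algebra (unknowns I \<Otimes>\<^sub>M Data I))"
  shows "unknowns_marginal I P \<in> space (prob_algebra (unknowns I))"
proof -
  have "sets P = sets (unknowns I \<Otimes>\<^sub>M Data I)" "prob_space P"
    using assms by (auto simp: space_prob_algebra)
  then show ?thesis
    by (auto simp: space_prob_algebra unknowns_marginal_def cong: measurable_cong_sets
        intro!: prob_space.prob_space_distr)
qed

text \<open>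
  Disintegration: with the conditional distribution of \<open>x\<close> given \<open>h\<close> prescribed, a joint measure
  is determined by its marginal on \<open>h\<close>. This is why an admissible solution always comes from a
  prior.
\<close>

lemma likelihood_consistent_iff_joint_measure:
  assumes I: "is_inference_problem I"
    and P: "P \<in> space (prob_algebra (unknowns I \<Otimes>\<^sub>M Data I))"
  shows "likelihood_consistent I P \<longleftrightarrow> P = joint_measure I (unknowns_marginal I P)"
proof -
  let ?\<pi> = "unknowns_marginal I P"
  have sets_P: "sets P = sets (unknowns I \<Otimes>\<^sub>M Data I)" and prob_P: "prob_space P"
    using P by (auto simp: space_prob_algebra)
  interpret P: prob_space P by fact
  note \<pi> = unknowns_marginal_in_prob_algebra[OF P]
  have sets_J: "sets (joint_measure I ?\<pi>) = sets (unknowns I \<Otimes>\<^sub>M Data I)"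
    using joint_measure_in_prob_algebra[OF I \<pi>] by (simp add: space_prob_algebra)
  have rect: "snd -` B \<inter> fst -` C \<inter> space P = C \<times> B"
    if "C \<in> sets (unknowns I)" "B \<in> sets (Data I)" for B C
    using that[THEN sets.sets_into_space]
    by (auto simp: sets_eq_imp_space_eq[OF sets_P] space_pair_measure)
  have cond_distr_iff: "is_cond_distr P (Data I) snd (unknowns I) fst \<kappa> \<longleftrightarrow>
      (\<forall>B\<in>sets (Data I). \<forall>C\<in>sets (unknowns I).
        (\<integral>\<^sup>+h. emeasure (\<kappa> h) B * indicator C h \<partial>?\<pi>) = emeasure P (C \<times> B))"
    if \<kappa>: "\<kappa> \<in> unknowns I \<rightarrow>\<^sub>M prob_algebra (Data I)" for \<kappa>
    unfolding unknowns_marginal_def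
    by (subst is_cond_distr_iff_nn_integral[OF prob_P _ _ \<kappa>])
      (simp_all cong: measurable_cong_sets add: sets_P rect)
  show ?thesis
  proof
    assume joint: "P = joint_measure I ?\<pi>"
    have "emeasure P (C \<times> B) = (\<integral>\<^sup>+h. emeasure (likelihood I h) B * indicator C h \<partial>?\<pi>)"
      if "C \<in> sets (unknowns I)" "B \<in> sets (Data I)" for B C
      using emeasure_joint_measure_Times[OF I \<pi> that] unfolding joint[symmetric] .
    then have "is_cond_distr P (Data I) snd (unknowns I) fst (likelihood I)"
      by (simp add: cond_distr_iff[OF likelihood_kernel[OF I \<pi>]])
    then show "likelihood_consistent I P"
      by (auto simp: likelihood_consistent_def)
  next
    assume "likelihood_consistent I P"
    then obtain \<kappa> where \<kappa>: "is_cond_distr P (Data I) snd (unknowns I) fst \<kappa>"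
      and ae: "AE h in ?\<pi>. \<kappa> h = likelihood I h"
      by (auto simp: likelihood_consistent_def)
    have \<kappa>_kernel: "\<kappa> \<in> unknowns I \<rightarrow>\<^sub>M prob_algebra (Data I)"
      using \<kappa> by (simp add: is_cond_distr_def)
    have eq: "emeasure P (C \<times> B) = emeasure (joint_measure I ?\<pi>) (C \<times> B)"
      if C: "C \<in> sets (unknowns I)" and B: "B \<in> sets (Data I)" for B C
    proof -
      have "emeasure P (C \<times> B) = (\<integral>\<^sup>+h. emeasure (\<kappa> h) B * indicator C h \<partial>?\<pi>)"
        using \<kappa> B C by (simp add: cond_distr_iff[OF \<kappa>_kernel])
      also have "\<dots> = (\<integral>\<^sup>+h. emeasure (likelihood I h) B * indicator C h \<partial>?\<pi>)"
        using ae by (intro nn_integral_cong_AE) auto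
      finally show ?thesis
        using emeasure_joint_measure_Times[OF I \<pi> C B] by simp
    qed
    let ?G = "{C \<times> B | C B. C \<in> sets (unknowns I) \<and> B \<in> sets (Data I)}"
    let ?\<Omega> = "space (unknowns I) \<times> space (Data I)"
    show "P = joint_measure I ?\<pi>"
    proof (rule measure_eqI_generator_eq_countable[where E="?G" and \<Omega>="?\<Omega>" and A="{?\<Omega>}"])
      show "Int_stable ?G" by (rule Int_stable_pair_measure_generator)
      show "?G \<subseteq> Pow ?\<Omega>" by (rule pair_measure_closed)
      show "sets P = sigma_sets ?\<Omega> ?G" "sets (joint_measure I ?\<pi>) = sigma_sets ?\<Omega> ?G"
        unfolding sets_P sets_J by (rule sets_pair_measure)+
      show "emeasure P X = emeasure (joint_measure I ?\<pi>) X" if "X \<in> ?G" for X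
        using that eq by blast
      show "emeasure P X \<noteq> \<infinity>" if "X \<in> {?\<Omega>}" for X
        by simp
    qed auto
  qed
qed

section \<open>Admissible solutions are Bayesian solutions\<close>

lemma admissible_joint_joint_measure:
  assumes I: "is_inference_problem I" and prior: "is_prior I \<pi>"
    and info: "agrees_with_information I \<pi>" and R: "bayesian_solution I \<pi> R"
  shows "admissible_joint I R (joint_measure I \<pi>)"
proof -
  have \<pi>: "\<pi> \<in> space (prob_algebra (unknowns I))"
    using prior by (simp add: is_prior_def)
  note J = joint_measure_in_prob_algebra[OF I \<pi>] and marg = unknowns_marginal_joint_measure[OF I \<pi>]
  show ?thesis
    using J prior info R marg likelihood_consistent_iff_joint_measure[OF I J]
      bayesian_solution_iff_answer_consistent[OF I \<pi>]
    by (simp add: admissible_joint_def restriction_consistent_def reality_consistent_def is_prior_def)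
qed

lemma admissible_joint_imp_bayesian:
  assumes I: "is_inference_problem I" and R: "prob_family I R" and P: "admissible_joint I R P"
  shows "is_prior I (unknowns_marginal I P)"
    and "agrees_with_information I (unknowns_marginal I P)"
    and "bayesian_solution I (unknowns_marginal I P) R"
proof -
  have P': "P \<in> space (prob_algebra (unknowns I \<Otimes>\<^sub>M Data I))"
    and joint: "P = joint_measure I (unknowns_marginal I P)"
    using P likelihood_consistent_iff_joint_measure[OF I] unfolding admissible_joint_def by blast+
  note \<pi> = unknowns_marginal_in_prob_algebra[OF P']
  show "is_prior I (unknowns_marginal I P)" "agrees_with_information I (unknowns_marginal I P)"
    using P \<pi> by (simp_all add: admissible_joint_def is_prior_def restriction_consistent_def
        reality_consistent_def)
  show "bayesian_solution I (unknowns_marginal I P) R"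
    unfolding bayesian_solution_iff_answer_consistent[OF I \<pi>] joint[symmetric]
    using P R by (simp add: admissible_joint_def)
qed

theorem mainTheorem1:
  fixes I :: "('t, 'f, 'x) inference_problem"
  assumes "is_inference_problem I"
  shows "(\<forall>\<pi> R. is_prior I \<pi> \<and> agrees_with_information I \<pi> \<and> bayesian_solution I \<pi> R \<longrightarrow>
            admissible_joint I R (joint_measure I \<pi>) \<and> admissible_solution I R) \<and>
         (\<forall>R. admissible_solution I R \<longrightarrow>
            (\<exists>P. admissible_joint I R P) \<and>
            (\<forall>P. admissible_joint I R P \<longrightarrow>
               is_prior I (unknowns_marginal I P) \<and>
               agrees_with_information I (unknowns_marginal I P) \<and>
               bayesian_solution I (unknowns_marginal I P) R))"
  using admissible_joint_joint_measure[OF assms] admissible_joint_imp_bayesian[OF assms]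
  by (auto simp: admissible_solution_def bayesian_solution_def)

end
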